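(* Let $n,w$ be integers with $n/2<w\le n$. (1) Let $D\subset\{0,1\}^w$ be a code all of whose words have weight at least $2w-n$, and let $n_k$ be the number of words of weight $k$ in $D$. Let $C_1\subset\{0,1\}^n$ be the set of words obtained by taking all words of $\{0,1\}^w$ not belonging to $D$ and completing them with $0$ on the last $n-w$ coordinates. Let $C_2\subset\{0,1\}^n$ be the set of words of weight exactly $w$ whose projection on the first $w$ coordinates belongs to $D$. Then $C_1$ and $C_2$ are disjoint, $|C_1|=2^w-|D|$, $|C_2|=\sum_k n_k\binom{n-w}{w-k}$, and $C=C_1\cup C_2$ has the $w$-witness property. (2) For every integer $t$ with $1\le t\le \frac{n-w}{2}$, taking $D$ to be the set of words of weight $w-t$ in $\{0,1\}^w$ in (1), one has $$f(n,w)\ge |C| = 2^w+\binom{w}{w-t}\left(\binom{n-w}{t}-1\right).$$ (3) If moreover $2^w>\binom{n}{\lfloor n/2\rfloor}$ and $w<n-1$, then for every such $t$ the code $C$ of (2) satisfies $$f(n,w)\ge|C|>\max\left(\binom{n}{w},\binom{n}{\lfloor n/2\rfloor},2^w\right).$$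
   Context: Write $[n]=\{1,\dots,n\}$. A (binary) code of length $n$ is a set $C\subset\{0,1\}^n$. For $W\subset[n]$, let $\pi_W:\{0,1\}^n\to\{0,1\}^W$, $x\mapsto (x_i)_{i\in W}$. For $c\in C$, a set $W\subset[n]$ is a witness set (witness) for $c$ in $C$ if $\pi_W(c)\neq\pi_W(c')$ for every $c'\in C$ with $c'\neq c$. A code $C$ has the $w$-witness property (is a $w$-witness code) if each of its codewords has a witness set of size $w$. For $w\le n$, $f(n,w)$ denotes the maximum cardinality of a $w$-witness code of length $n$. The weight of a word is its number of nonzero coordinates. *)

theory Defs
  imports Complex_Main "HOL-Library.FuncSet"
begin

text \<open>
  A word in \<open>{0,1}\<^sup>I\<close> is an extensional function on the index set \<open>I\<close>. Outside \<open>I\<close> it takes the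
  unspecified value \<^const>\<open>undefined\<close>, so the weight refers to \<open>I\<close> explicitly.
\<close>

definition words :: "nat set \<Rightarrow> (nat \<Rightarrow> nat) set" where
  "words I = I \<rightarrow>\<^sub>E {0, 1}"

definition weight :: "nat set \<Rightarrow> (nat \<Rightarrow> nat) \<Rightarrow> nat" where
  "weight I x = card {i \<in> I. x i \<noteq> 0}"

definition proj :: "nat set \<Rightarrow> (nat \<Rightarrow> nat) \<Rightarrow> (nat \<Rightarrow> nat)" where
  "proj W x = restrict x W"

definition is_code :: "nat \<Rightarrow> (nat \<Rightarrow> nat) set \<Rightarrow> bool" where
  "is_code n C \<longleftrightarrow> C \<subseteq> words {1..n}"

definition is_witness :: "nat \<Rightarrow> (nat \<Rightarrow> nat) set \<Rightarrow> (nat \<Rightarrow> nat) \<Rightarrow> nat set \<Rightarrow> bool" where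
  "is_witness n C c W \<longleftrightarrow> W \<subseteq> {1..n} \<and> (\<forall>c'\<in>C. c' \<noteq> c \<longrightarrow> proj W c \<noteq> proj W c')"

definition witness_code :: "nat \<Rightarrow> nat \<Rightarrow> (nat \<Rightarrow> nat) set \<Rightarrow> bool" where
  "witness_code n w C \<longleftrightarrow> is_code n C \<and> (\<forall>c\<in>C. \<exists>W. is_witness n C c W \<and> card W = w)"

definition max_witness_code :: "nat \<Rightarrow> nat \<Rightarrow> nat" where
  "max_witness_code n w = Max {card C | C. witness_code n w C}"

definition pad_zero :: "nat \<Rightarrow> nat \<Rightarrow> (nat \<Rightarrow> nat) \<Rightarrow> (nat \<Rightarrow> nat)" where
  "pad_zero n w x = (\<lambda>i\<in>{1..n}. if i \<le> w then x i else 0)"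

definition C1 :: "nat \<Rightarrow> nat \<Rightarrow> (nat \<Rightarrow> nat) set \<Rightarrow> (nat \<Rightarrow> nat) set" where
  "C1 n w D = pad_zero n w ` (words {1..w} - D)"

definition C2 :: "nat \<Rightarrow> nat \<Rightarrow> (nat \<Rightarrow> nat) set \<Rightarrow> (nat \<Rightarrow> nat) set" where
  "C2 n w D = {x \<in> words {1..n}. weight {1..n} x = w \<and> proj {1..w} x \<in> D}"

definition layer :: "nat \<Rightarrow> nat \<Rightarrow> (nat \<Rightarrow> nat) set" where
  "layer m k = {x \<in> words {1..m}. weight {1..m} x = k}"

end

theory Submission
  imports Defs
begin

text \<open>
  Throughout, a word is identified with its support, the set of its nonzero coordinates.

  The witness property rests on two different kinds of witness. A word of \<open>C1\<close> is witnessed by the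
  first \<open>w\<close> coordinates: projecting \<open>C\<close> there sends \<open>C1\<close> injectively to the complement of \<open>D\<close> and
  \<open>C2\<close> into \<open>D\<close>. A word of \<open>C2\<close> is witnessed by its own support, of size \<open>w\<close>: a word agreeing with
  it there has a support containing its support, and every word of \<open>C\<close> has at most \<open>w\<close> nonzero
  coordinates, so the two supports are equal (lemma \<open>witness_support\<close>). The bound on the weights of
  \<open>C1\<close> holds because its words vanish on the last \<open>n - w\<close> coordinates.

  The size of \<open>C2\<close> is found by fibring it over \<open>D\<close>: extending a word of weight \<open>k\<close> to one of
  weight \<open>w\<close> amounts to choosing \<open>w - k\<close> of the last \<open>n - w\<close> coordinates (lemma
  \<open>card_extensions\<close>). With \<open>D\<close> a layer only one \<open>k\<close> contributes, which gives part (2). In part (3),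
  \<open>1 \<le> t < n - w\<close> gives \<open>(n - w) choose t \<ge> 2\<close>, so \<open>C\<close> is strictly larger than
  \<open>2 ^ w\<close>, which exceeds the central binomial coefficient and hence also \<open>n choose w\<close>.
\<close>

section \<open>Words and their supports\<close>

definition supp :: "nat set \<Rightarrow> (nat \<Rightarrow> nat) \<Rightarrow> nat set" where
  "supp I x = {i \<in> I. x i \<noteq> 0}"

definition word_of :: "nat set \<Rightarrow> nat set \<Rightarrow> nat \<Rightarrow> nat" where
  "word_of I B = (\<lambda>i\<in>I. if i \<in> B then 1 else 0)"

lemma weight_supp: "weight I x = card (supp I x)"
  by (simp add: weight_def supp_def)

lemma supp_subset: "supp I x \<subseteq> I"
  by (auto simp: supp_def)

lemma word_of_in_words: "word_of I B \<in> words I"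
  by (auto simp: word_of_def words_def)

lemma supp_word_of: "supp I (word_of I B) = I \<inter> B"
  by (auto simp: word_of_def supp_def)

lemma word_of_supp:
  assumes "x \<in> words I"
  shows "word_of I (supp I x) = x"
proof
  fix i
  show "word_of I (supp I x) i = x i"
    using assms by (cases "i \<in> I") (auto simp: word_of_def supp_def words_def PiE_iff extensional_def)
qed

lemma word_eq_iff_supp:
  assumes "x \<in> words I" "y \<in> words I"
  shows "x = y \<longleftrightarrow> supp I x = supp I y"
  by (metis assms word_of_supp)

lemma supp_mono: "J \<subseteq> I \<Longrightarrow> supp J x \<subseteq> supp I x"
  by (auto simp: supp_def)

lemma supp_proj: "supp J (proj J x) = supp J x"
  by (auto simp: supp_def proj_def)

lemma proj_in_words: "x \<in> words I \<Longrightarrow> J \<subseteq> I \<Longrightarrow> proj J x \<in> words J"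
  by (auto simp: words_def proj_def PiE_iff)

lemma proj_eq_iff_supp:
  assumes "x \<in> words I" "y \<in> words I" "J \<subseteq> I"
  shows "proj J x = proj J y \<longleftrightarrow> supp J x = supp J y"
  using word_eq_iff_supp[OF proj_in_words[OF assms(1,3)] proj_in_words[OF assms(2,3)]]
  by (simp add: supp_proj)

lemma weight_le_card: "finite I \<Longrightarrow> weight I x \<le> card I"
  unfolding weight_supp by (rule card_mono[OF _ supp_subset])

lemma finite_words: "finite I \<Longrightarrow> finite (words I)"
  by (auto simp: words_def intro: finite_PiE)

lemma card_words: "finite I \<Longrightarrow> card (words I) = 2 ^ card I"
  by (simp add: words_def card_PiE numeral_2_eq_2)

text \<open>
  The extensions of \<open>x\<close> of weight \<open>v\<close> correspond to the sets of \<open>v - weight J x\<close> coordinates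
  outside \<open>J\<close> on which they are nonzero.
\<close>

lemma card_extensions:
  assumes fin: "finite I" and JI: "J \<subseteq> I" and x: "x \<in> words J" and le: "weight J x \<le> v"
  shows "card {y \<in> words I. weight I y = v \<and> proj J y = x} =
    card (I - J) choose (v - weight J x)"
    (is "card ?F = _")
proof -
  define S where "S = supp J x"
  have SJ: "S \<subseteq> J" unfolding S_def by (rule supp_subset)
  have finS: "finite S" using SJ JI fin by (meson finite_subset)
  let ?B = "{B. B \<subseteq> I - J \<and> card B = v - weight J x}"
  have "bij_betw (\<lambda>B. word_of I (S \<union> B)) ?B ?F"
  proof (rule bij_betw_byWitness[where f' = "\<lambda>y. supp I y - J"])
    show "\<forall>B\<in>?B. supp I (word_of I (S \<union> B)) - J = B"
      using SJ by (auto simp: supp_word_of)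
  next
    show "\<forall>y\<in>?F. word_of I (S \<union> (supp I y - J)) = y"
    proof
      fix y assume y: "y \<in> ?F"
      then have "S = supp J y" unfolding S_def using supp_proj by auto
      then have "S \<union> (supp I y - J) = supp I y" using JI by (auto simp: supp_def)
      then show "word_of I (S \<union> (supp I y - J)) = y" using y word_of_supp by auto
    qed
  next
    show "(\<lambda>B. word_of I (S \<union> B)) ` ?B \<subseteq> ?F"
    proof (rule image_subsetI)
      fix B assume B: "B \<in> ?B"
      have "finite B" using B fin by (auto intro: finite_subset)
      have "S \<inter> B = {}" using B SJ by auto
      then have "card (S \<union> B) = v"
        using B le finS \<open>finite B\<close> by (simp add: card_Un_disjoint S_def weight_supp)
      moreover have "I \<inter> (S \<union> B) = S \<union> B" using B SJ JI by auto
      ultimately have wt: "weight I (word_of I (S \<union> B)) = v"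
        by (simp add: weight_supp supp_word_of)
      have "supp J (word_of I (S \<union> B)) = S"
        using B SJ JI by (auto simp: supp_def word_of_def)
      then have "proj J (word_of I (S \<union> B)) = x"
        using word_eq_iff_supp[OF proj_in_words[OF word_of_in_words JI] x]
        by (simp add: supp_proj S_def)
      with wt show "word_of I (S \<union> B) \<in> ?F" by (simp add: word_of_in_words)
    qed
  next
    show "(\<lambda>y. supp I y - J) ` ?F \<subseteq> ?B"
    proof (rule image_subsetI)
      fix y assume y: "y \<in> ?F"
      then have S: "S = supp J y" unfolding S_def using supp_proj by auto
      have "supp I y - J = supp I y - S" unfolding S by (auto simp: supp_def)
      moreover have "S \<subseteq> supp I y" using S JI by (simp add: supp_mono)
      ultimately have "card (supp I y - J) = v - weight J x"
        using y finS by (simp add: card_Diff_subset weight_supp S_def)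
      then show "supp I y - J \<in> ?B" using supp_subset by auto
    qed
  qed
  then have "card ?F = card ?B" by (simp add: bij_betw_same_card)
  then show ?thesis using fin by (simp add: n_subsets)
qed

lemma card_layer: "card (layer m k) = m choose k"
proof -
  have "proj {} y = word_of {} {}" for y by (simp add: proj_def word_of_def restrict_def)
  moreover have "weight {} (word_of {} {}) = 0" by (simp add: weight_def)
  ultimately show ?thesis
    using card_extensions[of "{1..m}" "{}" "word_of {} {}" k]
    by (simp add: layer_def word_of_in_words)
qed

section \<open>Cardinalities of the two parts\<close>

lemma pad_zero_eq_word_of:
  assumes "w \<le> n" "x \<in> words {1..w}"
  shows "pad_zero n w x = word_of {1..n} (supp {1..w} x)"
proof
  fix i
  have "i \<in> {1..w} \<Longrightarrow> x i = 0 \<or> x i = 1" using assms(2) by (auto simp: words_def PiE_iff)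
  then show "pad_zero n w x i = word_of {1..n} (supp {1..w} x) i"
    by (auto simp: pad_zero_def word_of_def supp_def)
qed

lemma proj_pad_zero:
  assumes "w \<le> n" "x \<in> words {1..w}"
  shows "proj {1..w} (pad_zero n w x) = x"
proof
  fix i
  show "proj {1..w} (pad_zero n w x) i = x i"
    using assms by (cases "i \<in> {1..w}")
      (auto simp: proj_def pad_zero_def words_def PiE_iff extensional_def)
qed

lemma C1_words:
  assumes "w \<le> n" "c \<in> C1 n w D"
  shows "c \<in> words {1..n}" "weight {1..n} c \<le> w" "proj {1..w} c \<in> words {1..w} - D"
proof -
  obtain x where x: "x \<in> words {1..w} - D" "c = pad_zero n w x"
    using assms by (auto simp: C1_def)
  have c: "c = word_of {1..n} (supp {1..w} x)" using x assms pad_zero_eq_word_of by auto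
  then show "c \<in> words {1..n}" by (simp add: word_of_in_words)
  have "supp {1..n} c \<subseteq> {1..w}" using supp_subset[of "{1..w}" x] by (auto simp: c supp_word_of)
  then show "weight {1..n} c \<le> w" using card_mono[of "{1..w}"] by (fastforce simp: weight_supp)
  show "proj {1..w} c \<in> words {1..w} - D" using x assms proj_pad_zero by auto
qed

lemma inj_on_proj_C1:
  assumes "w \<le> n"
  shows "inj_on (proj {1..w}) (C1 n w D)"
proof (rule inj_on_inverseI)
  fix c assume "c \<in> C1 n w D"
  then show "pad_zero n w (proj {1..w} c) = c" using proj_pad_zero[OF assms] by (auto simp: C1_def)
qed

lemma card_C1:
  assumes "w \<le> n" "is_code w D"
  shows "int (card (C1 n w D)) = 2 ^ w - int (card D)"
proof -
  have sub: "D \<subseteq> words {1..w}" using assms by (simp add: is_code_def)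
  have fin: "finite (words {1..w})" by (simp add: finite_words)
  have "inj_on (pad_zero n w) (words {1..w} - D)"
    by (rule inj_on_inverseI[where g = "proj {1..w}"]) (use assms proj_pad_zero in auto)
  then have "card (C1 n w D) = card (words {1..w} - D)" by (simp add: C1_def card_image)
  also have "\<dots> = card (words {1..w}) - card D"
    using sub fin by (meson card_Diff_subset finite_subset)
  finally show ?thesis using card_mono[OF fin sub] by (simp add: card_words of_nat_diff)
qed

lemma C1_C2_disjoint:
  assumes "w \<le> n"
  shows "C1 n w D \<inter> C2 n w D = {}"
  using C1_words(3)[OF assms] by (fastforce simp: C2_def)

lemma card_C2:
  assumes wn: "w \<le> n" and D: "is_code w D"
  shows "card (C2 n w D) =
    (\<Sum>k = 0..w. card {x \<in> D. weight {1..w} x = k} * ((n - w) choose (w - k)))"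
proof -
  let ?F = "\<lambda>x. {y \<in> words {1..n}. weight {1..n} y = w \<and> proj {1..w} y = x}"
  have sub: "D \<subseteq> words {1..w}" using D by (simp add: is_code_def)
  have fin: "finite D" using sub finite_words[of "{1..w}"] by (auto intro: finite_subset)
  have wt: "weight {1..w} x \<le> w" for x using weight_le_card[of "{1..w}" x] by simp
  have "{1..n} - {1..w} = {w+1..n}" using wn by auto
  then have fib: "card (?F x) = (n - w) choose (w - weight {1..w} x)" if "x \<in> D" for x
    using card_extensions[of "{1..n}" "{1..w}" x w] that sub wn wt by auto
  have "C2 n w D = (\<Union>x\<in>D. ?F x)" by (auto simp: C2_def)
  then have "card (C2 n w D) = (\<Sum>x\<in>D. card (?F x))"
    using fin by (auto simp: finite_words intro!: card_UN_disjoint)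
  also have "\<dots> = (\<Sum>x\<in>D. (n - w) choose (w - weight {1..w} x))" using fib by simp
  also have "\<dots> = (\<Sum>k = 0..w. \<Sum>x\<in>{x \<in> D. weight {1..w} x = k}.
      (n - w) choose (w - weight {1..w} x))"
    by (rule sum.group[symmetric]) (use fin wt in auto)
  also have "\<dots> = (\<Sum>k = 0..w. card {x \<in> D. weight {1..w} x = k} * ((n - w) choose (w - k)))"
    by simp
  finally show ?thesis .
qed

section \<open>The witness property\<close>

text \<open>
  If \<open>c'\<close> agrees with \<open>c\<close> on the support of \<open>c\<close>, then the support of \<open>c'\<close> contains that of \<open>c\<close>;
  so in a code of weight at most \<open>weight {1..n} c\<close> the supports coincide.
\<close>

lemma witness_support:
  assumes C: "is_code n C" and c: "c \<in> C"
    and le: "\<And>c'. c' \<in> C \<Longrightarrow> weight {1..n} c' \<le> weight {1..n} c"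
  shows "is_witness n C c (supp {1..n} c)"
  unfolding is_witness_def
proof (intro conjI ballI impI notI)
  show "supp {1..n} c \<subseteq> {1..n}" by (rule supp_subset)
next
  fix c' assume c': "c' \<in> C" "c' \<noteq> c" and eq: "proj (supp {1..n} c) c = proj (supp {1..n} c) c'"
  have w: "c \<in> words {1..n}" "c' \<in> words {1..n}" using C c c' by (auto simp: is_code_def)
  have "supp (supp {1..n} c) c' = supp (supp {1..n} c) c"
    using eq proj_eq_iff_supp[OF w supp_subset] by simp
  then have "supp {1..n} c \<subseteq> supp {1..n} c'" by (auto simp: supp_def)
  moreover have "finite (supp {1..n} c')" by (simp add: supp_def)
  ultimately have "supp {1..n} c = supp {1..n} c'"
    using le[OF c'(1)] by (simp add: weight_supp card_seteq)
  then show False using w c'(2) word_eq_iff_supp by blast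
qed

lemma witness_code_C1_C2:
  assumes wn: "w \<le> n"
  shows "witness_code n w (C1 n w D \<union> C2 n w D)"
proof -
  let ?C = "C1 n w D \<union> C2 n w D"
  have code: "is_code n ?C"
    using C1_words(1)[OF wn] by (auto simp: is_code_def C2_def)
  have wt: "weight {1..n} c \<le> w" if "c \<in> ?C" for c
    using that C1_words(2)[OF wn] by (auto simp: C2_def)
  have "\<exists>W. is_witness n ?C c W \<and> card W = w" if c: "c \<in> ?C" for c
    using c
  proof
    assume c1: "c \<in> C1 n w D"
    have "proj {1..w} c \<noteq> proj {1..w} c'" if "c' \<in> ?C" "c' \<noteq> c" for c'
      using that(1)
    proof
      assume "c' \<in> C1 n w D"
      then show ?thesis using inj_on_proj_C1[OF wn] c1 that by (metis inj_onD)
    next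
      assume "c' \<in> C2 n w D"
      then have "proj {1..w} c' \<in> D" by (simp add: C2_def)
      then show ?thesis using C1_words(3)[OF wn c1] by auto
    qed
    then have "is_witness n ?C c {1..w}" using wn by (auto simp: is_witness_def)
    then show ?thesis by auto
  next
    assume "c \<in> C2 n w D"
    then have "weight {1..n} c = w" by (simp add: C2_def)
    then have "is_witness n ?C c (supp {1..n} c) \<and> card (supp {1..n} c) = w"
      using witness_support[OF code c] wt by (simp add: weight_supp)
    then show ?thesis by blast
  qed
  with code show ?thesis by (simp add: witness_code_def)
qed

lemma card_le_max_witness_code:
  assumes "witness_code n w C"
  shows "card C \<le> max_witness_code n w"
proof -
  have "{C. witness_code n w C} \<subseteq> Pow (words {1..n})"
    by (auto simp: witness_code_def is_code_def)
  then have "finite {C. witness_code n w C}"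
    by (rule finite_subset) (simp add: finite_words)
  then have "finite {card C | C. witness_code n w C}" by simp
  then show ?thesis unfolding max_witness_code_def using assms by (intro Max_ge) auto
qed

section \<open>Taking a layer\<close>

lemma is_code_layer: "is_code m (layer m k)"
  by (auto simp: is_code_def layer_def)

lemma card_C_layer:
  assumes wn: "w \<le> n" and tw: "t \<le> w"
  shows "int (card (C1 n w (layer w (w - t)) \<union> C2 n w (layer w (w - t)))) =
    2 ^ w + int (w choose (w - t)) * (int ((n - w) choose t) - 1)"
proof -
  let ?D = "layer w (w - t)"
  have "card {x \<in> ?D. weight {1..w} x = k} = (if k = w - t then card ?D else 0)" for k
  proof -
    have "{x \<in> ?D. weight {1..w} x = k} = (if k = w - t then ?D else {})"
      by (auto simp: layer_def)
    then show ?thesis by (metis card.empty)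
  qed
  then have "card (C2 n w ?D) =
      (\<Sum>k = 0..w. (if k = w - t then card ?D else 0) * ((n - w) choose (w - k)))"
    using card_C2[OF wn is_code_layer] by presburger
  also have "\<dots> = (\<Sum>k = 0..w. if k = w - t then card ?D * ((n - w) choose (w - k)) else 0)"
    by (rule sum.cong) auto
  also have "\<dots> = (w choose (w - t)) * ((n - w) choose t)"
    using tw by (simp add: card_layer)
  finally have c2: "card (C2 n w ?D) = (w choose (w - t)) * ((n - w) choose t)" .
  have fin: "finite (C1 n w ?D)" "finite (C2 n w ?D)"
    using finite_words[of "{1..w}"] finite_words[of "{1..n}"] by (simp_all add: C1_def C2_def)
  have "card (C1 n w ?D \<union> C2 n w ?D) = card (C1 n w ?D) + card (C2 n w ?D)"
    using fin C1_C2_disjoint[OF wn] by (simp add: card_Un_disjoint)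
  then show ?thesis
    using card_C1[OF wn is_code_layer] by (simp add: c2 card_layer algebra_simps)
qed

lemma choose_ge_2:
  fixes m t :: nat
  assumes "1 \<le> t" "t < m"
  shows "2 \<le> m choose t"
proof -
  obtain m' t' where "m = Suc m'" "t = Suc t'" using assms by (cases m; cases t) auto
  moreover have "0 < m' choose t'" "0 < m' choose Suc t'" using assms calculation by auto
  ultimately show ?thesis unfolding \<open>m = Suc m'\<close> \<open>t = Suc t'\<close> binomial_Suc_Suc by linarith
qed

theorem mainTheorem3:
  fixes n w :: nat
  assumes "real n / 2 < real w" and "w \<le> n"
  shows
    "(\<forall>D. is_code w D \<and> (\<forall>x\<in>D. int (weight {1..w} x) \<ge> 2 * int w - int n) \<longrightarrow>
        C1 n w D \<inter> C2 n w D = {} \<and>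
        int (card (C1 n w D)) = 2 ^ w - int (card D) \<and>
        card (C2 n w D) =
          (\<Sum>k = 0..w. card {x \<in> D. weight {1..w} x = k} * ((n - w) choose (w - k))) \<and>
        witness_code n w (C1 n w D \<union> C2 n w D))
     \<and>
     (\<forall>t::nat. 1 \<le> t \<and> real t \<le> (real n - real w) / 2 \<longrightarrow>
        (let D = layer w (w - t); C = C1 n w D \<union> C2 n w D in
          max_witness_code n w \<ge> card C \<and>
          int (card C) =
            2 ^ w + int (w choose (w - t)) * (int ((n - w) choose t) - 1)))
     \<and>
     (2 ^ w > n choose (n div 2) \<and> int w < int n - 1 \<longrightarrow>
        (\<forall>t::nat. 1 \<le> t \<and> real t \<le> (real n - real w) / 2 \<longrightarrow>
          (let D = layer w (w - t); C = C1 n w D \<union> C2 n w D in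
            max_witness_code n w \<ge> card C \<and>
            card C > Max {n choose w, n choose (n div 2), 2 ^ w})))"
proof -
  note wn = assms(2)
  \<comment> \<open>The hypothesis \<open>n < 2 * w\<close> bounds \<open>t\<close> by \<open>w\<close>, so the natural number \<open>w - t\<close> is a true difference.\<close>
  have tw: "t \<le> w" if "real t \<le> (real n - real w) / 2" for t
  proof -
    have "0 \<le> real w" by simp
    then have "real t \<le> real w" using that assms(1) by argo
    then show ?thesis by simp
  qed
  have lower: "max_witness_code n w \<ge> card (C1 n w D \<union> C2 n w D)" for D
    using card_le_max_witness_code[OF witness_code_C1_C2[OF wn]] .
  have large: "card (C1 n w (layer w (w - t)) \<union> C2 n w (layer w (w - t))) >
      Max {n choose w, n choose (n div 2), 2 ^ w}"
    if big: "2 ^ w > n choose (n div 2)" and "int w < int n - 1" and t: "1 \<le> t"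
      and tle: "real t \<le> (real n - real w) / 2" for t
  proof -
    have "real t < real (n - w)" using t tle wn by (simp add: of_nat_diff)
    then have "t < n - w" by simp
    then have "1 \<le> int ((n - w) choose t) - 1" using choose_ge_2[OF t] by fastforce
    moreover have "0 < int (w choose (w - t))" by simp
    ultimately have "0 < int (w choose (w - t)) * (int ((n - w) choose t) - 1)" by simp
    then have "int (2 ^ w) < int (card (C1 n w (layer w (w - t)) \<union> C2 n w (layer w (w - t))))"
      using card_C_layer[OF wn tw[OF tle]] by simp
    then have "2 ^ w < card (C1 n w (layer w (w - t)) \<union> C2 n w (layer w (w - t)))"
      using of_nat_less_iff by blast
    moreover have "n choose w \<le> n choose (n div 2)" by (rule binomial_maximum)
    ultimately show ?thesis using big by simp
  qed
  show ?thesis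
    unfolding Let_def
    using C1_C2_disjoint[OF wn] card_C1[OF wn] card_C2[OF wn] witness_code_C1_C2[OF wn]
      lower card_C_layer[OF wn] tw large
    by blast
qed

end
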